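(* Let $A$ be a unital good normed algebra, let $I=[0,1]$ and let $n$ be a positive integer. Then $n$ belongs to the absolute connected stable range of $A$ if and only if $n\ge tsr(C(I,A))$. Consequently, $acsr(A)=tsr(C(I,A))$.
   Context: All algebras are complex. A normed algebra is a normed space with an algebra structure and submultiplicative norm. A unital topological algebra $A$ is good if its set $A^{-1}$ of invertible elements is open and $x\mapsto x^{-1}$ is continuous on $A^{-1}$. $C(I,A)$ is the algebra of continuous functions $I\to A$ with the supremum norm. For a unital algebra $A$, $Lg_n(A)$ is the set of $(a_1,\dots,a_n)\in A^n$ with $Aa_1+\cdots+Aa_n=A$. The topological stable rank $tsr(A)$ of a unital topological algebra $A$ is the smallest positive integer $n$ such that $Lg_n(A)$ is dense in $A^n$ (product topology), or $\infty$ if no such integer exists. A positive integer $n$ belongs to the absolute connected stable range of $A$ if for every nonempty connected open subset $V$ of $A^n$, the set $V\cap Lg_n(A)$ is nonempty and connected. The absolute connected stable rank $acsr(A)$ is the least integer $n$ such that every $m\ge n$ belongs to the absolute connected stable range of $A$, or $\infty$ if no such integer exists. (Connectedness here means path-connectedness.) *)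

theory Defs
  imports "HOL-Analysis.Analysis" "HOL-Library.Extended_Nat"
begin

section \<open>Unital complex normed algebras\<close>

text \<open>
  The norm is submultiplicative, but neither \<open>norm 1 = 1\<close> nor \<open>1 \<noteq> 0\<close> is required, so
  \<open>monoid_mult\<close> is used instead of \<open>ring_1\<close> and \<open>real_normed_algebra_1\<close>. No completeness is
  assumed. The real structure is the restriction of the complex one.
\<close>

class complex_normed_unital_algebra = real_normed_algebra + monoid_mult +
  fixes scaleC :: "complex \<Rightarrow> 'a \<Rightarrow> 'a"
  assumes scaleC_add_right: "scaleC c (x + y) = scaleC c x + scaleC c y"
    and scaleC_add_left: "scaleC (c + d) x = scaleC c x + scaleC d x"
    and scaleC_scaleC: "scaleC c (scaleC d x) = scaleC (c * d) x"
    and scaleC_of_real: "scaleC (complex_of_real r) x = scaleR r x"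
    and mult_scaleC_left: "scaleC c x * y = scaleC c (x * y)"
    and mult_scaleC_right: "x * scaleC c y = scaleC c (x * y)"
    and norm_scaleC: "norm (scaleC c x) = cmod c * norm x"

section \<open>Good algebras\<close>

definition invertibles :: "'a::monoid_mult set" where
  "invertibles = {x. \<exists>y. x * y = 1 \<and> y * x = 1}"

text \<open>Only meaningful on \<^const>\<open>invertibles\<close>, where the inverse is unique.\<close>

definition algebra_inverse :: "'a::monoid_mult \<Rightarrow> 'a" where
  "algebra_inverse x = (THE y. x * y = 1 \<and> y * x = 1)"

definition good_algebra :: "'a::{topological_space, monoid_mult} itself \<Rightarrow> bool" where
  "good_algebra _ \<longleftrightarrow>
     open (invertibles :: 'a set) \<and> continuous_on (invertibles :: 'a set) algebra_inverse"

section \<open>Stable ranks\<close>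

text \<open>
  The power \<open>A\<^sup>n\<close> is the set of functions on \<open>{..<n}\<close> (extended by \<^const>\<open>undefined\<close>) with the
  product topology; its underlying set is \<open>{..<n} \<rightarrow>\<^sub>E UNIV\<close>.
\<close>

definition power_topology :: "nat \<Rightarrow> (nat \<Rightarrow> 'a::topological_space) topology" where
  "power_topology n = product_topology (\<lambda>_. euclidean) {..<n}"

definition Lg :: "nat \<Rightarrow> (nat \<Rightarrow> 'a::ring) set" where
  "Lg n = {a \<in> {..<n} \<rightarrow>\<^sub>E UNIV. {\<Sum>i<n. x i * a i | x. True} = UNIV}"

text \<open>In both ranks below, \<^term>\<open>Inf {} = (\<infinity>::enat)\<close> gives the value when no integer qualifies.\<close>

definition tsr :: "'a::{topological_space, ring, monoid_mult} itself \<Rightarrow> enat" where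
  "tsr _ = Inf {enat n | n. n > 0 \<and>
     (power_topology n :: (nat \<Rightarrow> 'a) topology) closure_of Lg n =
       topspace (power_topology n)}"

definition in_acs_range :: "'a::{topological_space, ring, monoid_mult} itself \<Rightarrow> nat \<Rightarrow> bool" where
  "in_acs_range _ n \<longleftrightarrow> n > 0 \<and>
     (\<forall>V :: (nat \<Rightarrow> 'a) set.
        openin (power_topology n) V \<and> V \<noteq> {} \<and> path_connectedin (power_topology n) V \<longrightarrow>
        V \<inter> Lg n \<noteq> {} \<and> path_connectedin (power_topology n) (V \<inter> Lg n))"

definition acsr :: "'a::{topological_space, ring, monoid_mult} itself \<Rightarrow> enat" where
  "acsr _ = Inf {enat n | n. n > 0 \<and> (\<forall>m\<ge>n. in_acs_range TYPE('a) m)}"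

section \<open>The algebra of continuous functions on the unit interval\<close>

text \<open>
  A continuous function on \<open>[0,1]\<close> is represented by its extension by \<open>0\<close> to the whole line.
\<close>

typedef (overloaded) 'a C_I =
  "{f :: real \<Rightarrow> 'a::real_normed_vector. continuous_on {0..1} f \<and> (\<forall>t. t \<notin> {0..1} \<longrightarrow> f t = 0)}"
  morphisms apply_C_I Abs_C_I
  by (rule exI[of _ "\<lambda>_. 0"]) auto

setup_lifting type_definition_C_I

lemma C_I_eqI: "(\<And>t. t \<in> {0..1} \<Longrightarrow> apply_C_I f t = apply_C_I g t) \<Longrightarrow> f = g"
  by transfer (metis ext)

lemma continuous_on_apply_C_I: "continuous_on {0..1} (apply_C_I f)"
  by transfer simp

lemma bdd_above_norm_C_I: "bdd_above ((\<lambda>t. norm (apply_C_I f t)) ` {0..1})"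
  by (intro compact_imp_bounded compact_continuous_image continuous_on_norm
      continuous_on_apply_C_I compact_Icc bounded_imp_bdd_above)

instantiation C_I :: (real_normed_vector) real_vector
begin

lift_definition zero_C_I :: "'a C_I" is "\<lambda>_. 0" by simp

lift_definition plus_C_I :: "'a C_I \<Rightarrow> 'a C_I \<Rightarrow> 'a C_I" is "\<lambda>f g t. f t + g t"
  by (auto intro!: continuous_intros)

lift_definition uminus_C_I :: "'a C_I \<Rightarrow> 'a C_I" is "\<lambda>f t. - f t"
  by (auto intro!: continuous_intros)

lift_definition minus_C_I :: "'a C_I \<Rightarrow> 'a C_I \<Rightarrow> 'a C_I" is "\<lambda>f g t. f t - g t"
  by (auto intro!: continuous_intros)

lift_definition scaleR_C_I :: "real \<Rightarrow> 'a C_I \<Rightarrow> 'a C_I" is "\<lambda>r f t. r *\<^sub>R f t"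
  by (auto intro!: continuous_intros)

instance
  by standard (transfer; force simp: algebra_simps)+

end

instantiation C_I :: (real_normed_vector) real_normed_vector
begin

definition norm_C_I :: "'a C_I \<Rightarrow> real" where
  "norm_C_I f = (SUP t\<in>{0..1}. norm (apply_C_I f t))"

definition dist_C_I :: "'a C_I \<Rightarrow> 'a C_I \<Rightarrow> real" where
  "dist_C_I f g = norm (f - g)"

definition sgn_C_I :: "'a C_I \<Rightarrow> 'a C_I" where
  "sgn_C_I f = inverse (norm f) *\<^sub>R f"

definition uniformity_C_I :: "('a C_I \<times> 'a C_I) filter" where
  "uniformity_C_I = (INF e\<in>{0 <..}. principal {(x, y). dist x y < e})"

definition open_C_I :: "'a C_I set \<Rightarrow> bool" where
  "open_C_I S = (\<forall>x\<in>S. \<forall>\<^sub>F (x', y) in uniformity. x' = x \<longrightarrow> y \<in> S)"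

lemma norm_apply_le_C_I: "t \<in> {0..1} \<Longrightarrow> norm (apply_C_I f t) \<le> norm f"
  unfolding norm_C_I_def by (rule cSUP_upper[OF _ bdd_above_norm_C_I])

lemma norm_C_I_leI: "(\<And>t. t \<in> {0..1} \<Longrightarrow> norm (apply_C_I f t) \<le> b) \<Longrightarrow> norm f \<le> b"
  unfolding norm_C_I_def by (rule cSUP_least) auto

lemma norm_C_I_nonneg: "0 \<le> norm (f :: 'a C_I)"
  using norm_apply_le_C_I[of 0 f] by (auto intro: order_trans[OF norm_ge_zero])

instance
proof
  fix f g :: "'a C_I" and r :: real
  show "norm f = 0 \<longleftrightarrow> f = 0"
  proof
    assume "norm f = 0"
    then show "f = 0"
      using norm_apply_le_C_I[of _ f] by (intro C_I_eqI) (simp add: zero_C_I.rep_eq)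
  next
    assume "f = 0"
    then show "norm f = 0"
      using norm_C_I_nonneg[of f] norm_C_I_leI[of f 0] by (simp add: zero_C_I.rep_eq)
  qed
  show "norm (f + g) \<le> norm f + norm g"
    by (rule norm_C_I_leI)
      (auto simp: plus_C_I.rep_eq intro!: norm_triangle_mono norm_apply_le_C_I)
  have le: "norm (s *\<^sub>R h) \<le> \<bar>s\<bar> * norm h" for s and h :: "'a C_I"
    by (rule norm_C_I_leI) (auto simp: scaleR_C_I.rep_eq intro!: mult_left_mono norm_apply_le_C_I)
  show "norm (r *\<^sub>R f) = \<bar>r\<bar> * norm f"
  proof (cases "r = 0")
    case True
    then show ?thesis
      using le[of r f] norm_C_I_nonneg[of "r *\<^sub>R f"] by simp
  next
    case False
    then have "norm f \<le> \<bar>inverse r\<bar> * norm (r *\<^sub>R f)"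
      using le[of "inverse r" "r *\<^sub>R f"] by simp
    then have "\<bar>r\<bar> * norm f \<le> norm (r *\<^sub>R f)"
      using False by (simp add: field_simps)
    then show ?thesis
      using le[of r f] by simp
  qed
qed (simp_all only: dist_C_I_def sgn_C_I_def uniformity_C_I_def open_C_I_def)

end

instantiation C_I :: (real_normed_algebra) real_normed_algebra
begin

lift_definition times_C_I :: "'a C_I \<Rightarrow> 'a C_I \<Rightarrow> 'a C_I" is "\<lambda>f g t. f t * g t"
  by (auto intro!: continuous_intros)

instance
proof
  fix f g h :: "'a C_I" and r :: real
  show "f * g * h = f * (g * h)" by transfer (simp add: mult.assoc)
  show "(f + g) * h = f * h + g * h" by transfer (simp add: distrib_right)
  show "f * (g + h) = f * g + f * h" by transfer (simp add: distrib_left)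
  show "r *\<^sub>R f * g = r *\<^sub>R (f * g)" by transfer simp
  show "f * r *\<^sub>R g = r *\<^sub>R (f * g)" by transfer simp
  show "norm (f * g) \<le> norm f * norm g"
    by (rule norm_C_I_leI) (auto simp: times_C_I.rep_eq norm_C_I_nonneg
        intro!: order_trans[OF norm_mult_ineq] mult_mono norm_apply_le_C_I)
qed

end

instantiation C_I :: (complex_normed_unital_algebra) complex_normed_unital_algebra
begin

lift_definition one_C_I :: "'a C_I" is "\<lambda>t. if t \<in> {0..1} then 1 else 0"
  by (auto intro: continuous_on_eq[OF continuous_on_const])

lift_definition scaleC_C_I :: "complex \<Rightarrow> 'a C_I \<Rightarrow> 'a C_I" is "\<lambda>c f t. scaleC c (f t)"
proof -
  fix c :: complex and f :: "real \<Rightarrow> 'a"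
  assume f: "continuous_on {0..1} f \<and> (\<forall>t. t \<notin> {0..1} \<longrightarrow> f t = 0)"
  have "bounded_linear (scaleC c :: 'a \<Rightarrow> 'a)"
    by (rule bounded_linear_intro[of _ "cmod c"])
      (simp_all add: scaleC_add_right norm_scaleC scaleC_scaleC mult.commute
        flip: scaleC_of_real)
  from bounded_linear.continuous_on[OF this] bounded_linear.linear[OF this] f
  show "continuous_on {0..1} (\<lambda>t. scaleC c (f t)) \<and> (\<forall>t. t \<notin> {0..1} \<longrightarrow> scaleC c (f t) = 0)"
    by (auto simp: linear_0)
qed

instance
proof
  fix f g :: "'a C_I" and c d :: complex and r :: real
  show "1 * f = f" by transfer (auto simp: fun_eq_iff)
  show "f * 1 = f" by transfer (auto simp: fun_eq_iff)
  show "scaleC c (f + g) = scaleC c f + scaleC c g" by transfer (simp add: scaleC_add_right)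
  show "scaleC (c + d) f = scaleC c f + scaleC d f" by transfer (simp add: scaleC_add_left)
  show "scaleC c (scaleC d f) = scaleC (c * d) f" by transfer (simp add: scaleC_scaleC)
  show "scaleC (complex_of_real r) f = r *\<^sub>R f" by transfer (simp add: scaleC_of_real)
  show "scaleC c f * g = scaleC c (f * g)" by transfer (simp add: mult_scaleC_left)
  show "f * scaleC c g = scaleC c (f * g)" by transfer (simp add: mult_scaleC_right)
  have "norm (scaleC c f) = (SUP t\<in>{0..1}. norm (apply_C_I (cmod c *\<^sub>R f) t))"
    by (simp add: norm_C_I_def scaleC_C_I.rep_eq scaleR_C_I.rep_eq norm_scaleC)
  then show "norm (scaleC c f) = cmod c * norm f"
    by (simp flip: norm_C_I_def)
qed

end

end

theory Submission
  imports Defs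
begin

text \<open>
  Elements of \<open>C(I,A)\<^sup>n\<close> are the paths in \<open>A\<^sup>n\<close>. Since \<open>A\<close> is good, \<open>Lg\<^sub>n(A)\<close> is open and left inverses
  of a path in \<open>Lg\<^sub>n(A)\<close> can be chosen continuously near each parameter; if \<open>y\<close> is a left inverse of
  \<open>a\<close>, then so is \<open>z + (1 - z \<cdot> a) y\<close> for every \<open>z\<close>, which allows local choices to be glued. Hence a path
  belongs to \<open>Lg\<^sub>n(C(I,A))\<close> iff it runs inside \<open>Lg\<^sub>n(A)\<close>. If these paths are dense, then a path in an
  open set \<open>V\<close> can be perturbed into \<open>V \<inter> Lg\<^sub>n(A)\<close>. Conversely, if \<open>n\<close> is in the absolute connected
  stable range, a path is approximated by covering it with small boxes, picking points of
  \<open>Lg\<^sub>n(A)\<close> in consecutive overlaps and joining them inside the boxes.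
\<close>

section \<open>Finite powers of metric spaces\<close>

lemma topspace_power_topology [simp]: "topspace (power_topology n) = {..<n} \<rightarrow>\<^sub>E UNIV"
  by (simp add: power_topology_def topspace_product_topology)

text \<open>Open cubes are the balls of the maximum metric on \<open>A\<^sup>n\<close>. They give
  quantitative neighbourhoods although tuples are extensional functions that carry only an abstract
  topology.\<close>

definition power_ball :: "nat \<Rightarrow> (nat \<Rightarrow> 'a::metric_space) \<Rightarrow> real \<Rightarrow> (nat \<Rightarrow> 'a) set" where
  "power_ball n x r = (\<Pi>\<^sub>E i\<in>{..<n}. ball (x i) r)"

lemma mem_power_ball:
  "y \<in> power_ball n x r \<longleftrightarrow> y \<in> {..<n} \<rightarrow>\<^sub>E UNIV \<and> (\<forall>i<n. dist (x i) (y i) < r)"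
  unfolding power_ball_def PiE_iff by auto

text \<open>\<open>power_ball\<close> reads only the values of its centre below \<open>n\<close>, so
  a centre lies in its own cube only if it is extensional. \<open>power_ball_commute\<close> needs
  the same hypothesis.\<close>

lemma power_ball_centre:
  "x \<in> {..<n} \<rightarrow>\<^sub>E UNIV \<Longrightarrow> r > 0 \<Longrightarrow> x \<in> power_ball n x r"
  by (simp add: mem_power_ball)

lemma power_ball_mono: "r \<le> s \<Longrightarrow> power_ball n x r \<subseteq> power_ball n x s"
  by (fastforce simp: mem_power_ball)

lemma power_ball_commute:
  "x \<in> {..<n} \<rightarrow>\<^sub>E UNIV \<Longrightarrow> y \<in> power_ball n x r \<Longrightarrow> x \<in> power_ball n y r"
  by (simp add: mem_power_ball dist_commute)

lemma power_ball_triangle: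
  assumes "y \<in> power_ball n x r" "z \<in> power_ball n y s"
  shows "z \<in> power_ball n x (r + s)"
  unfolding mem_power_ball
proof (intro conjI allI impI)
  show "z \<in> {..<n} \<rightarrow>\<^sub>E UNIV" using assms by (simp add: mem_power_ball)
  fix i assume "i < n"
  then have "dist (x i) (y i) < r" "dist (y i) (z i) < s"
    using assms by (simp_all add: mem_power_ball)
  then show "dist (x i) (z i) < r + s"
    using dist_triangle[of "x i" "z i" "y i"] by linarith
qed

lemma openin_power_ball: "openin (power_topology n) (power_ball n x r)"
  by (simp add: power_topology_def power_ball_def openin_PiE)

lemma path_connectedin_power_ball:
  fixes x :: "nat \<Rightarrow> 'a::real_normed_vector"
  shows "path_connectedin (power_topology n) (power_ball n x r)"
  by (simp add: power_topology_def power_ball_def path_connectedin_PiE convex_imp_path_connected)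

text \<open>A basic open box around \<open>x\<close> restricts finitely many coordinates, so the
  least of the coordinate radii serves for all of them.\<close>

lemma openin_power_topology_iff:
  fixes U :: "(nat \<Rightarrow> 'a::metric_space) set"
  shows "openin (power_topology n) U \<longleftrightarrow>
    U \<subseteq> {..<n} \<rightarrow>\<^sub>E UNIV \<and> (\<forall>x\<in>U. \<exists>e>0. power_ball n x e \<subseteq> U)"
    (is "_ \<longleftrightarrow> ?R")
proof
  assume U: "openin (power_topology n) U"
  show ?R
  proof (intro conjI ballI)
    show "U \<subseteq> {..<n} \<rightarrow>\<^sub>E UNIV"
      using openin_subset[OF U] by simp
    fix x assume "x \<in> U"
    with U obtain W where "\<forall>i\<in>{..<n}. openin euclidean (W i)" and x: "x \<in> PiE {..<n} W"
      and WU: "PiE {..<n} W \<subseteq> U"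
      unfolding power_topology_def openin_product_topology_alt by blast
    then have W: "\<And>i. i < n \<Longrightarrow> open (W i)" by simp
    have "\<exists>e>0. ball (x i) e \<subseteq> W i" if "i < n" for i
      using W[OF that] PiE_mem[OF x, of i] that by (simp add: open_contains_ball)
    then obtain d where d: "\<And>i. i < n \<Longrightarrow> d i > 0 \<and> ball (x i) (d i) \<subseteq> W i"
      by metis
    \<comment> \<open>Inserting 1 keeps \<open>Min\<close> meaningful when
      \<open>n = 0\<close>.\<close>
    define e where "e = Min (insert 1 (d ` {..<n}))"
    have e: "e > 0" "\<And>i. i < n \<Longrightarrow> e \<le> d i"
      using d by (auto simp: e_def)
    have "power_ball n x e \<subseteq> PiE {..<n} W"
      unfolding power_ball_def
    proof (rule PiE_mono)
      fix i assume "i \<in> {..<n}"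
      then have "ball (x i) e \<subseteq> ball (x i) (d i)" "ball (x i) (d i) \<subseteq> W i"
        using e(2) d by (simp_all add: subset_ball)
      then show "ball (x i) e \<subseteq> W i" by (rule order_trans)
    qed
    then show "\<exists>e>0. power_ball n x e \<subseteq> U"
      using WU e(1) by blast
  qed
next
  assume R: ?R
  show "openin (power_topology n) U"
  proof (subst openin_subopen, intro ballI)
    fix x assume x: "x \<in> U"
    with R obtain e where e: "e > 0" "power_ball n x e \<subseteq> U" by blast
    moreover have "x \<in> power_ball n x e"
      using x R e(1) by (intro power_ball_centre) auto
    ultimately show "\<exists>T. openin (power_topology n) T \<and> x \<in> T \<and> T \<subseteq> U"
      using openin_power_ball by blast
  qed
qed


section \<open>Paths in finite powers\<close>

lemma continuous_map_power_iff:
  "continuous_map (top_of_set S) (power_topology n) g \<longleftrightarrow>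
     (\<forall>t\<in>S. g t \<in> {..<n} \<rightarrow>\<^sub>E UNIV) \<and> (\<forall>i<n. continuous_on S (\<lambda>t. g t i))"
  by (auto simp: power_topology_def continuous_map_componentwise PiE_def)

lemma pathin_power_iff:
  "pathin (power_topology n) g \<longleftrightarrow>
     (\<forall>t\<in>{0..1}. g t \<in> {..<n} \<rightarrow>\<^sub>E UNIV) \<and> (\<forall>i<n. continuous_on {0..1} (\<lambda>t. g t i))"
  by (simp add: pathin_def continuous_map_power_iff)

lemma pathin_power_near:
  fixes g :: "real \<Rightarrow> nat \<Rightarrow> 'a::metric_space"
  assumes g: "pathin (power_topology n) g" and x: "x \<in> {0..1}" and e: "e > 0"
  obtains d where "d > 0"
    "\<And>t. t \<in> {0..1} \<Longrightarrow> dist x t < d \<Longrightarrow> g t \<in> power_ball n (g x) e"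
proof -
  have "openin (top_of_set {0..1}) {t \<in> topspace (top_of_set {0..1}). g t \<in> power_ball n (g x) e}"
    using g openin_power_ball unfolding pathin_def by (rule openin_continuous_map_preimage)
  moreover have "x \<in> {t \<in> topspace (top_of_set {0..1}). g t \<in> power_ball n (g x) e}"
    using x e g by (simp add: power_ball_centre pathin_power_iff)
  ultimately obtain d where "d > 0"
    "ball x d \<inter> {0..1} \<subseteq> {t \<in> topspace (top_of_set {0..1}). g t \<in> power_ball n (g x) e}"
    unfolding openin_contains_ball by blast
  then show ?thesis by (intro that) auto
qed

lemma continuous_on_glue:
  fixes f g :: "real \<Rightarrow> 'a::topological_space"
  assumes "continuous_on {a..b} f" "continuous_on {b..c} g" "f b = g b" "a \<le> b" "b \<le> c"
  shows "continuous_on {a..c} (\<lambda>t. if t \<le> b then f t else g t)"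
proof -
  have "{a..c} = {a..b} \<union> {b..c}" using assms by auto
  then show ?thesis
    using assms by (auto intro!: continuous_on_cases)
qed

text \<open>A Lebesgue number argument, carried out by bisection: a property of intervals that
  passes to unions of adjacent intervals and holds on all short intervals around each point holds on
  \<open>{0..1}\<close>.\<close>

lemma pathin_uniform_neighbourhood:
  fixes g :: "real \<Rightarrow> nat \<Rightarrow> 'a::metric_space"
  assumes g: "pathin (power_topology n) g" and V: "openin (power_topology n) V"
    and gV: "\<And>t. t \<in> {0..1} \<Longrightarrow> g t \<in> V"
  obtains e where "e > 0" "\<And>t. t \<in> {0..1} \<Longrightarrow> power_ball n (g t) e \<subseteq> V"
proof -
  \<comment> \<open>Short intervals around an endpoint may stick out of \<open>{0..1}\<close>, hence
    the intersection.\<close>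
  define P where "P a b \<longleftrightarrow> (\<exists>e>0. \<forall>t\<in>{a..b} \<inter> {0..1}. power_ball n (g t) e \<subseteq> V)" for a b
  have "P 0 1"
  proof (rule Bolzano)
    fix a b c assume "P a b" "P b c" and abc: "a \<le> b" "b \<le> c"
    then obtain d e where d: "d > 0" "\<forall>t\<in>{a..b} \<inter> {0..1}. power_ball n (g t) d \<subseteq> V"
      and e: "e > 0" "\<forall>t\<in>{b..c} \<inter> {0..1}. power_ball n (g t) e \<subseteq> V"
      unfolding P_def by blast
    have "power_ball n (g t) (min d e) \<subseteq> V" if "t \<in> {a..c} \<inter> {0..1}" for t
    proof -
      have "t \<in> {a..b} \<inter> {0..1} \<or> t \<in> {b..c} \<inter> {0..1}" using that by auto
      then have "power_ball n (g t) d \<subseteq> V \<or> power_ball n (g t) e \<subseteq> V" using d(2) e(2) by blast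
      moreover have "power_ball n (g t) (min d e) \<subseteq> power_ball n (g t) d"
        "power_ball n (g t) (min d e) \<subseteq> power_ball n (g t) e"
        by (simp_all add: power_ball_mono)
      ultimately show ?thesis by blast
    qed
    moreover have "min d e > 0" using d(1) e(1) by simp
    ultimately show "P a c" unfolding P_def by blast
  next
    fix x :: real assume x: "0 \<le> x" "x \<le> 1"
    then obtain e where e: "e > 0" "power_ball n (g x) e \<subseteq> V"
      using V gV[of x] unfolding openin_power_topology_iff by auto
    \<comment> \<open>One half of \<open>e\<close> pays for moving the centre from
      \<open>g x\<close> to \<open>g t\<close>, the other half is the radius kept at
      \<open>g t\<close>.\<close>
    obtain d where d: "d > 0"
      "\<And>t. t \<in> {0..1} \<Longrightarrow> dist x t < d \<Longrightarrow> g t \<in> power_ball n (g x) (e/2)"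
      using pathin_power_near[OF g, of x "e/2"] x e(1) by auto
    have "P a b" if ab: "a \<le> x" "x \<le> b" "b - a < d" for a b
    proof -
      have "power_ball n (g t) (e/2) \<subseteq> V" if t: "t \<in> {a..b} \<inter> {0..1}" for t
      proof
        fix y assume "y \<in> power_ball n (g t) (e/2)"
        moreover have "g t \<in> power_ball n (g x) (e/2)"
          using t ab by (intro d(2)) (auto simp: dist_real_def)
        ultimately have "y \<in> power_ball n (g x) (e/2 + e/2)"
          by (intro power_ball_triangle)
        then show "y \<in> V" using e(2) by auto
      qed
      then show ?thesis using e(1) half_gt_zero unfolding P_def by blast
    qed
    then show "\<exists>d>0. \<forall>a b. a \<le> x \<and> x \<le> b \<and> b - a < d \<longrightarrow> P a b" using d(1) by blast
  qed simp
  then obtain e where "e > 0" "\<forall>t\<in>{0..1}. power_ball n (g t) e \<subseteq> V"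
    by (auto simp: P_def)
  then show ?thesis by (intro that) auto
qed

section \<open>Left invertible tuples\<close>

text \<open>A left ideal is the whole algebra iff it contains 1: the coefficients of 1 multiplied on
  the left by \<open>b\<close> represent \<open>b\<close>.\<close>

lemma Lg_iff:
  fixes a :: "nat \<Rightarrow> 'a::{ring, monoid_mult}"
  shows "a \<in> Lg n \<longleftrightarrow> a \<in> {..<n} \<rightarrow>\<^sub>E UNIV \<and> (\<exists>x. (\<Sum>i<n. x i * a i) = 1)"
proof -
  have "{\<Sum>i<n. x i * a i |x. True} = UNIV \<longleftrightarrow> (\<exists>x. (\<Sum>i<n. x i * a i) = 1)"
  proof
    assume "{\<Sum>i<n. x i * a i |x. True} = UNIV"
    then have "1 \<in> {\<Sum>i<n. x i * a i |x. True}" by simp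
    then show "\<exists>x. (\<Sum>i<n. x i * a i) = 1" by auto
  next
    assume "\<exists>x. (\<Sum>i<n. x i * a i) = 1"
    then obtain x where x: "(\<Sum>i<n. x i * a i) = 1" by blast
    have "b = (\<Sum>i<n. (b * x i) * a i)" for b
      by (simp add: mult.assoc x flip: sum_distrib_left)
    then show "{\<Sum>i<n. x i * a i |x. True} = UNIV" by fast
  qed
  then show ?thesis by (simp add: Lg_def)
qed

lemma Lg_memI:
  fixes a :: "nat \<Rightarrow> 'a::{ring, monoid_mult}"
  assumes "a \<in> {..<n} \<rightarrow>\<^sub>E UNIV" "(\<Sum>i<n. x i * a i) = 1"
  shows "a \<in> Lg n"
  using assms unfolding Lg_iff by blast

lemma Lg_memE:
  fixes a :: "nat \<Rightarrow> 'a::{ring, monoid_mult}"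
  assumes "a \<in> Lg n"
  obtains x where "(\<Sum>i<n. x i * a i) = 1"
  using assms unfolding Lg_iff by blast

section \<open>Openness of \<open>Lg n\<close> and continuous choice of left inverses\<close>

lemma algebra_inverse_left: "x \<in> invertibles \<Longrightarrow> algebra_inverse x * x = 1"
proof -
  assume "x \<in> invertibles"
  then obtain y where y: "x * y = 1 \<and> y * x = 1" by (auto simp: invertibles_def)
  have "algebra_inverse x = y"
    unfolding algebra_inverse_def
    by (rule the_equality) (use y in \<open>auto, metis mult.assoc mult_1_left mult_1_right\<close>)
  with y show ?thesis by simp
qed

lemma one_in_invertibles: "1 \<in> invertibles"
  by (auto simp: invertibles_def)

text \<open>Fix a left inverse \<open>x\<close> of \<open>a\<close>. For \<open>y\<close> near
  \<open>a\<close> the sum of the \<open>x i * y i\<close> is near 1, hence invertible, and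
  multiplying \<open>x\<close> on the left by its inverse gives a left inverse of
  \<open>y\<close>.\<close>

lemma openin_Lg:
  assumes good: "good_algebra TYPE('a::complex_normed_unital_algebra)"
  shows "openin (power_topology n) (Lg n :: (nat \<Rightarrow> 'a) set)"
proof (subst openin_subopen, intro ballI)
  fix a :: "nat \<Rightarrow> 'a" assume "a \<in> Lg n"
  then obtain x where a: "a \<in> {..<n} \<rightarrow>\<^sub>E UNIV" and x: "(\<Sum>i<n. x i * a i) = 1"
    by (auto simp: Lg_iff)
  define T where "T = {y \<in> topspace (power_topology n). (\<Sum>i<n. x i * y i) \<in> invertibles}"
  have "continuous_map (power_topology n) euclidean (\<lambda>y. x i * y i)" if "i < n" for i
  proof -
    have "continuous_map (power_topology n) euclidean (\<lambda>y. y i :: 'a)"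
      using that unfolding power_topology_def
      by (auto intro: continuous_map_product_projection)
    then have "continuous_map (power_topology n) euclidean ((\<lambda>y. x i * y) \<circ> (\<lambda>y. y i))"
      by (rule continuous_map_compose) (auto intro!: continuous_intros)
    then show ?thesis by (simp add: o_def)
  qed
  then have "continuous_map (power_topology n) euclidean (\<lambda>y. \<Sum>i<n. x i * y i)"
    by (intro continuous_map_sum) auto
  then have "openin (power_topology n) T"
    unfolding T_def by (rule openin_continuous_map_preimage) (use good in \<open>simp add: good_algebra_def\<close>)
  moreover have "a \<in> T" using a x by (simp add: T_def one_in_invertibles)
  moreover have "T \<subseteq> Lg n"
  proof
    fix y assume y: "y \<in> T"
    have "(\<Sum>i<n. (algebra_inverse (\<Sum>i<n. x i * y i) * x i) * y i) = 1"
      using y by (simp add: mult.assoc T_def algebra_inverse_left flip: sum_distrib_left)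
    then show "y \<in> Lg n"
      using y by (intro Lg_memI[of _ _ "\<lambda>i. algebra_inverse (\<Sum>i<n. x i * y i) * x i"])
        (auto simp: T_def)
  qed
  ultimately show "\<exists>T. openin (power_topology n) T \<and> a \<in> T \<and> T \<subseteq> Lg n" by blast
qed

text \<open>Near a parameter \<open>s\<close>, a left inverse \<open>z\<close> of \<open>f s\<close>
  makes \<open>u t\<close>, the sum of the \<open>z i * f t i\<close>, invertible. Inversion being
  continuous, \<open>algebra_inverse (u t) * z i\<close> is a continuous local choice. Bisection and
  gluing make it global.\<close>

lemma continuous_left_inverse:
  fixes f :: "real \<Rightarrow> nat \<Rightarrow> 'a::complex_normed_unital_algebra"
  assumes good: "good_algebra TYPE('a)" and "a \<le> b"
    and f: "\<And>i. i < n \<Longrightarrow> continuous_on {a..b} (\<lambda>t. f t i)"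
    and inv: "\<And>t. t \<in> {a..b} \<Longrightarrow> \<exists>x. (\<Sum>i<n. x i * f t i) = 1"
  shows "\<exists>x. (\<forall>i<n. continuous_on {a..b} (\<lambda>t. x t i)) \<and>
           (\<forall>t\<in>{a..b}. (\<Sum>i<n. x t i * f t i) = 1)"
proof -
  \<comment> \<open>Bisection also tests intervals that leave \<open>{a..b}\<close>; the premise
    makes \<open>P\<close> vacuous there.\<close>
  define P where "P c d \<longleftrightarrow> (a \<le> c \<and> d \<le> b \<longrightarrow>
    (\<exists>x. (\<forall>i<n. continuous_on {c..d} (\<lambda>t. x t i)) \<and> (\<forall>t\<in>{c..d}. (\<Sum>i<n. x t i * f t i) = 1)))"
    for c d
  have "P a b"
    using \<open>a \<le> b\<close>
  proof (rule Bolzano)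
    fix c m d assume P: "P c m" "P m d" and le: "c \<le> m" "m \<le> d"
    show "P c d" unfolding P_def
    proof (intro impI)
      assume ab: "a \<le> c \<and> d \<le> b"
      from P le ab obtain x y
        where x: "\<And>i. i < n \<Longrightarrow> continuous_on {c..m} (\<lambda>t. x t i)"
            "\<And>t. t \<in> {c..m} \<Longrightarrow> (\<Sum>i<n. x t i * f t i) = 1"
          and y: "\<And>i. i < n \<Longrightarrow> continuous_on {m..d} (\<lambda>t. y t i)"
            "\<And>t. t \<in> {m..d} \<Longrightarrow> (\<Sum>i<n. y t i * f t i) = 1"
      proof -
        have "m \<le> b" "a \<le> m" using le ab by auto
        with P ab show ?thesis unfolding P_def by (elim impE exE conjE) (auto intro: that)
      qed
      \<comment> \<open>\<open>y\<close> is modified so as to agree with \<open>x\<close> at \<open>m\<close>.\<close>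
      define y' where "y' t i = x m i + (1 - (\<Sum>j<n. x m j * f t j)) * y t i" for t i
      define z where "z t i = (if t \<le> m then x t i else y' t i)" for t i
      have "continuous_on {m..d} (\<lambda>t. f t i)" if "i < n" for i
        using f[OF that] by (rule continuous_on_subset) (use ab le in auto)
      then have "continuous_on {m..d} (\<lambda>t. y' t i)" if "i < n" for i
        using that y(1) unfolding y'_def by (auto intro!: continuous_intros)
      \<comment> \<open>At \<open>t = m\<close> the sum inside \<open>y'\<close> equals 1, so the
        factor in front of \<open>y m i\<close> vanishes.\<close>
      moreover have "x m i = y' m i" for i
        using x(2)[of m] le by (simp add: y'_def)
      ultimately have z_cont: "continuous_on {c..d} (\<lambda>t. z t i)" if "i < n" for i
        unfolding z_def using that x(1) le by (intro continuous_on_glue) auto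
      \<comment> \<open>With \<open>S\<close> the sum of the \<open>x m j * f t j\<close>, the total
        is \<open>S + (1 - S)\<close>, because \<open>y t\<close> is a left inverse of
        \<open>f t\<close>.\<close>
      have y'_inv: "(\<Sum>i<n. y' t i * f t i) = 1" if "t \<in> {m..d}" for t
        using y(2)[OF that]
        by (simp add: y'_def distrib_right sum.distrib mult.assoc flip: sum_distrib_left)
      have "\<forall>t\<in>{c..d}. (\<Sum>i<n. z t i * f t i) = 1"
      proof (intro ballI)
        fix t assume "t \<in> {c..d}"
        then show "(\<Sum>i<n. z t i * f t i) = 1"
          using x(2)[of t] y'_inv[of t] by (cases "t \<le> m") (simp_all add: z_def)
      qed
      with z_cont show "\<exists>x. (\<forall>i<n. continuous_on {c..d} (\<lambda>t. x t i)) \<and>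
          (\<forall>t\<in>{c..d}. (\<Sum>i<n. x t i * f t i) = 1)" by blast
    qed
  next
    fix s assume s: "a \<le> s" "s \<le> b"
    then obtain z where z: "(\<Sum>i<n. z i * f s i) = 1" using inv[of s] by auto
    define u where "u t = (\<Sum>i<n. z i * f t i)" for t
    have u: "continuous_on {a..b} u"
      unfolding u_def by (auto intro!: continuous_intros f)
    have "openin (top_of_set {a..b}) ({a..b} \<inter> u -` invertibles)"
      using u good by (auto simp: good_algebra_def intro: continuous_openin_preimage_gen)
    moreover have "s \<in> {a..b} \<inter> u -` invertibles"
      using s z by (simp add: u_def one_in_invertibles)
    ultimately obtain r where r: "r > 0" "ball s r \<inter> {a..b} \<subseteq> {a..b} \<inter> u -` invertibles"
      unfolding openin_contains_ball by blast
    have "P c d" if cd: "c \<le> s" "s \<le> d" "d - c < r" for c d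
      unfolding P_def
    proof (intro impI)
      assume ab: "a \<le> c \<and> d \<le> b"
      have sub: "{c..d} \<subseteq> {a..b}" using ab by auto
      have inv: "u t \<in> invertibles" if "t \<in> {c..d}" for t
      proof -
        have "t \<in> ball s r \<inter> {a..b}" using that cd sub by (auto simp: dist_real_def)
        with r(2) show ?thesis by blast
      qed
      have "continuous_on {c..d} (\<lambda>t. algebra_inverse (u t))"
        by (rule continuous_on_compose2[of invertibles algebra_inverse])
          (use good inv continuous_on_subset[OF u sub] in \<open>auto simp: good_algebra_def\<close>)
      then have "\<forall>i<n. continuous_on {c..d} (\<lambda>t. algebra_inverse (u t) * z i)"
        by (auto intro!: continuous_intros)
      moreover have "\<forall>t\<in>{c..d}. (\<Sum>i<n. algebra_inverse (u t) * z i * f t i) = 1"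
        using algebra_inverse_left[OF inv] by (simp add: mult.assoc u_def flip: sum_distrib_left)
      ultimately show "\<exists>x. (\<forall>i<n. continuous_on {c..d} (\<lambda>t. x t i)) \<and>
          (\<forall>t\<in>{c..d}. (\<Sum>i<n. x t i * f t i) = 1)"
        by (intro exI[of _ "\<lambda>t i. algebra_inverse (u t) * z i"]) auto
    qed
    then show "\<exists>r>0. \<forall>c d. c \<le> s \<and> s \<le> d \<and> d - c < r \<longrightarrow> P c d" using r(1) by blast
  qed
  then show ?thesis by (simp add: P_def)
qed

section \<open>Tuples of functions as paths\<close>

text \<open>This identifies \<open>C(I,A)\<^sup>n\<close> with the paths in
  \<open>A\<^sup>n\<close>. The restriction makes every value extensional, whatever \<open>F\<close>
  and \<open>t\<close> are.\<close>

definition tuple_path :: "nat \<Rightarrow> (nat \<Rightarrow> 'a::real_normed_vector C_I) \<Rightarrow> real \<Rightarrow> nat \<Rightarrow> 'a" where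
  "tuple_path n F t = (\<lambda>i\<in>{..<n}. apply_C_I (F i) t)"

lemma tuple_path_in [simp]: "tuple_path n F t \<in> {..<n} \<rightarrow>\<^sub>E UNIV"
  by (simp add: tuple_path_def)

lemma tuple_path_apply [simp]: "i < n \<Longrightarrow> tuple_path n F t i = apply_C_I (F i) t"
  by (simp add: tuple_path_def)

lemma pathin_tuple_path: "pathin (power_topology n) (tuple_path n F)"
  by (simp add: pathin_power_iff continuous_on_apply_C_I)

lemma C_I_of_continuous:
  assumes "continuous_on {0..1} g"
  shows "\<exists>h. \<forall>t\<in>{0..1}. apply_C_I h t = g t"
proof -
  have "continuous_on {0..1} (\<lambda>t. if t \<in> {0..1} then g t else 0)"
    using assms by (rule continuous_on_eq) auto
  then show ?thesis
    by (intro exI[of _ "Abs_C_I (\<lambda>t. if t \<in> {0..1} then g t else 0)"]) (simp add: Abs_C_I_inverse)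
qed

text \<open>The converse passage from paths to tuples. Agreement is confined to
  \<open>{0..1}\<close>, since elements of \<open>C_I\<close> vanish elsewhere while
  \<open>g\<close> is arbitrary there.\<close>

lemma tuple_path_of_path:
  assumes g: "pathin (power_topology n) g"
  obtains F where "F \<in> {..<n} \<rightarrow>\<^sub>E UNIV" "\<And>t. t \<in> {0..1} \<Longrightarrow> tuple_path n F t = g t"
proof -
  have "\<forall>i\<in>{..<n}. \<exists>h. \<forall>t\<in>{0..1}. apply_C_I h t = g t i"
    using g by (auto simp: pathin_power_iff intro!: C_I_of_continuous)
  then obtain H where H: "\<And>i t. i < n \<Longrightarrow> t \<in> {0..1} \<Longrightarrow> apply_C_I (H i) t = g t i"
    by (metis lessThan_iff)
  show ?thesis
  proof (rule that)
    show "restrict H {..<n} \<in> {..<n} \<rightarrow>\<^sub>E UNIV" by simp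
    fix t :: real assume t: "t \<in> {0..1}"
    then have "g t \<in> {..<n} \<rightarrow>\<^sub>E UNIV" using g by (simp add: pathin_power_iff)
    then show "tuple_path n (restrict H {..<n}) t = g t"
      using H t by (intro PiE_ext[OF tuple_path_in]) auto
  qed
qed

lemma apply_C_I_sum: "apply_C_I (\<Sum>i\<in>S. f i) t = (\<Sum>i\<in>S. apply_C_I (f i) t)"
  by (induction S rule: infinite_finite_induct) (auto simp: plus_C_I.rep_eq zero_C_I.rep_eq)

lemma dist_apply_C_I_le: "t \<in> {0..1} \<Longrightarrow> dist (apply_C_I f t) (apply_C_I g t) \<le> dist f g"
  using norm_apply_le_C_I[of t "f - g"] by (simp add: dist_norm minus_C_I.rep_eq)

lemma dist_C_I_leI:
  "(\<And>t. t \<in> {0..1} \<Longrightarrow> dist (apply_C_I f t) (apply_C_I g t) \<le> b) \<Longrightarrow> dist f g \<le> b"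
  using norm_C_I_leI[of "f - g" b] by (simp add: dist_norm minus_C_I.rep_eq)

lemma tuple_path_power_ball:
  assumes "G \<in> power_ball n F r" "t \<in> {0..1}"
  shows "tuple_path n G t \<in> power_ball n (tuple_path n F t) r"
  unfolding mem_power_ball
proof (intro conjI allI impI)
  fix i assume i: "i < n"
  have "dist (apply_C_I (F i) t) (apply_C_I (G i) t) \<le> dist (F i) (G i)"
    using assms(2) by (rule dist_apply_C_I_le)
  also have "\<dots> < r" using assms(1) i by (simp add: mem_power_ball)
  finally show "dist (tuple_path n F t i) (tuple_path n G t i) < r" using i by simp
qed simp

text \<open>Evaluating an identity with value 1 in \<open>C(I,A)\<close> at each \<open>t\<close>
  gives one direction. For the other, the left inverses at the single parameters are replaced by a
  continuous family, whose coordinates are elements of \<open>C(I,A)\<close>.\<close>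

lemma Lg_C_I_iff:
  fixes F :: "nat \<Rightarrow> 'a::complex_normed_unital_algebra C_I"
  assumes good: "good_algebra TYPE('a)" and F: "F \<in> {..<n} \<rightarrow>\<^sub>E UNIV"
  shows "F \<in> Lg n \<longleftrightarrow> (\<forall>t\<in>{0..1}. tuple_path n F t \<in> Lg n)"
proof
  assume "F \<in> Lg n"
  then obtain X where X: "(\<Sum>i<n. X i * F i) = 1" by (auto simp: Lg_iff)
  have "(\<Sum>i<n. apply_C_I (X i) t * tuple_path n F t i) = 1" if "t \<in> {0..1}" for t
    using that arg_cong[OF X, of "\<lambda>h. apply_C_I h t"]
    by (simp add: apply_C_I_sum times_C_I.rep_eq one_C_I.rep_eq)
  then show "\<forall>t\<in>{0..1}. tuple_path n F t \<in> Lg n"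
    using Lg_memI[OF tuple_path_in, where x = "\<lambda>i. apply_C_I (X i) _"] by blast
next
  assume "\<forall>t\<in>{0..1}. tuple_path n F t \<in> Lg n"
  then have inv: "\<exists>x. (\<Sum>i<n. x i * tuple_path n F t i) = 1" if "t \<in> {0..1}" for t
    using that by (auto simp: Lg_iff)
  have "\<exists>x. (\<forall>i<n. continuous_on {0..1} (\<lambda>t. x t i)) \<and>
      (\<forall>t\<in>{0..1}. (\<Sum>i<n. x t i * tuple_path n F t i) = 1)"
    by (rule continuous_left_inverse[OF good]) (use inv in \<open>auto simp: continuous_on_apply_C_I\<close>)
  then obtain x where x: "\<And>i. i < n \<Longrightarrow> continuous_on {0..1} (\<lambda>t. x t i)"
      "\<And>t. t \<in> {0..1} \<Longrightarrow> (\<Sum>i<n. x t i * tuple_path n F t i) = 1"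
    by blast
  have "\<forall>i\<in>{..<n}. \<exists>h. \<forall>t\<in>{0..1}. apply_C_I h t = x t i"
    using x(1) by (auto intro!: C_I_of_continuous)
  then obtain X where X: "\<And>i t. i < n \<Longrightarrow> t \<in> {0..1} \<Longrightarrow> apply_C_I (X i) t = x t i"
    by (metis lessThan_iff)
  have "(\<Sum>i<n. X i * F i) = 1"
    by (rule C_I_eqI) (use x(2) in \<open>simp add: apply_C_I_sum times_C_I.rep_eq one_C_I.rep_eq X\<close>)
  then show "F \<in> Lg n" using F by (auto simp: Lg_iff)
qed

section \<open>Density\<close>

definition Lg_dense :: "'a::{metric_space, ring, monoid_mult} itself \<Rightarrow> nat \<Rightarrow> bool" where
  "Lg_dense _ n \<longleftrightarrow>
     (\<forall>f \<in> {..<n} \<rightarrow>\<^sub>E (UNIV :: 'a set). \<forall>e>0. Lg n \<inter> power_ball n f e \<noteq> {})"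

lemma Lg_subset: "Lg n \<subseteq> {..<n} \<rightarrow>\<^sub>E UNIV"
  by (auto simp: Lg_def)

text \<open>A set is dense iff it meets every nonempty open set, and each of these contains a
  cube.\<close>

lemma Lg_dense_iff:
  "Lg_dense TYPE('a::{metric_space, ring, monoid_mult}) n \<longleftrightarrow>
     (power_topology n :: (nat \<Rightarrow> 'a) topology) closure_of Lg n = topspace (power_topology n)"
proof -
  have "Lg_dense TYPE('a) n \<longleftrightarrow>
      (\<forall>T :: (nat \<Rightarrow> 'a) set. openin (power_topology n) T \<and> T \<noteq> {} \<longrightarrow> Lg n \<inter> T \<noteq> {})"
    (is "_ \<longleftrightarrow> ?D")
  proof
    assume D: "Lg_dense TYPE('a) n"
    show ?D
    proof (intro allI impI)
      fix T :: "(nat \<Rightarrow> 'a) set" assume T: "openin (power_topology n) T \<and> T \<noteq> {}"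
      then obtain f e where "f \<in> {..<n} \<rightarrow>\<^sub>E UNIV" "e > 0" "power_ball n f e \<subseteq> T"
        unfolding openin_power_topology_iff by blast
      then show "Lg n \<inter> T \<noteq> {}" using D unfolding Lg_dense_def by blast
    qed
  next
    assume D: ?D
    show "Lg_dense TYPE('a) n"
      unfolding Lg_dense_def
    proof (intro ballI allI impI)
      fix f :: "nat \<Rightarrow> 'a" and e :: real assume "f \<in> {..<n} \<rightarrow>\<^sub>E UNIV" "e > 0"
      then have "f \<in> power_ball n f e" by (rule power_ball_centre)
      with D openin_power_ball show "Lg n \<inter> power_ball n f e \<noteq> {}" by blast
    qed
  qed
  then show ?thesis by (simp only: dense_intersects_open)
qed

text \<open>Approximate the first \<open>n\<close> coordinates within \<open>Lg n\<close> and keep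
  the last one unchanged, giving it the coefficient 0.\<close>

lemma Lg_dense_Suc:
  assumes D: "Lg_dense TYPE('a::{metric_space, ring, monoid_mult}) n"
  shows "Lg_dense TYPE('a) (Suc n)"
  unfolding Lg_dense_def
proof (intro ballI allI impI)
  fix f :: "nat \<Rightarrow> 'a" and e :: real assume "f \<in> {..<Suc n} \<rightarrow>\<^sub>E UNIV" and e: "e > 0"
  have "restrict f {..<n} \<in> {..<n} \<rightarrow>\<^sub>E UNIV" by simp
  then obtain g where g: "g \<in> Lg n" "g \<in> power_ball n (restrict f {..<n}) e"
    using D e unfolding Lg_dense_def by blast
  obtain x where x: "(\<Sum>i<n. x i * g i) = 1" using Lg_memE[OF g(1)] .
  have "(\<Sum>i<Suc n. (x(n := 0)) i * (g(n := f n)) i) = 1"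
    using x by simp
  moreover have Pi: "g(n := f n) \<in> {..<Suc n} \<rightarrow>\<^sub>E UNIV"
    using g(1) by (auto simp: Lg_iff PiE_def extensional_def)
  ultimately have "g(n := f n) \<in> Lg (Suc n)" by (intro Lg_memI)
  moreover have "g(n := f n) \<in> power_ball (Suc n) f e"
    using Pi g(2) e by (auto simp: mem_power_ball less_Suc_eq)
  ultimately show "Lg (Suc n) \<inter> power_ball (Suc n) f e \<noteq> {}" by blast
qed

lemma Lg_dense_mono:
  assumes "Lg_dense TYPE('a::{metric_space, ring, monoid_mult}) m" "m \<le> n"
  shows "Lg_dense TYPE('a) n"
  using assms(2,1) by (induction rule: dec_induct) (auto intro: Lg_dense_Suc)

text \<open>A finite infimum in \<open>enat\<close> is attained, and density passes from the least
  admissible integer to all larger ones.\<close>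

lemma tsr_le_iff:
  assumes "n > 0"
  shows "tsr TYPE('a::{metric_space, ring, monoid_mult}) \<le> enat n \<longleftrightarrow> Lg_dense TYPE('a) n"
proof -
  let ?S = "{enat n | n. n > 0 \<and> Lg_dense TYPE('a) n}"
  have tsr: "tsr TYPE('a) = Inf ?S"
    by (simp add: tsr_def Lg_dense_iff)
  show ?thesis
  proof
    assume le: "tsr TYPE('a) \<le> enat n"
    then have "?S \<noteq> {}" unfolding tsr by (auto simp: Inf_enat_def split: if_splits)
    then have "Inf ?S \<in> ?S"
      unfolding Inf_enat_def by (metis (no_types, lifting) LeastI_ex ex_in_conv)
    with le show "Lg_dense TYPE('a) n"
      unfolding tsr by (auto intro: Lg_dense_mono)
  next
    assume "Lg_dense TYPE('a) n"
    with assms show "tsr TYPE('a) \<le> enat n"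
      unfolding tsr by (intro Inf_lower) auto
  qed
qed

section \<open>The absolute connected stable range\<close>

text \<open>Points \<open>x\<close> and \<open>y\<close> of \<open>W\<close> are joined by a path in
  \<open>V\<close>. A nearby path inside \<open>W\<close> has endpoints close to \<open>x\<close>
  and \<open>y\<close>, and small cubes contained in \<open>W\<close> connect these endpoints to
  \<open>x\<close> and \<open>y\<close>.\<close>

lemma in_acs_range_if_Lg_dense:
  assumes good: "good_algebra TYPE('a::complex_normed_unital_algebra)" and "n > 0"
    and D: "Lg_dense TYPE('a C_I) n"
  shows "in_acs_range TYPE('a) n"
  unfolding in_acs_range_def
proof (intro conjI allI impI)
  fix V :: "(nat \<Rightarrow> 'a) set"
  assume "openin (power_topology n) V \<and> V \<noteq> {} \<and> path_connectedin (power_topology n) V"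
  then have V: "openin (power_topology n) V" "V \<noteq> {}" "path_connectedin (power_topology n) V"
    by auto
  define W where "W = V \<inter> Lg n"
  have W: "openin (power_topology n) W"
    unfolding W_def using V(1) openin_Lg[OF good] by (rule openin_Int)
  have approx: "\<exists>h. pathin (power_topology n) h \<and> (\<forall>t\<in>{0..1}. h t \<in> W \<inter> power_ball n (g t) d)"
    if g: "pathin (power_topology n) g" "\<And>t. t \<in> {0..1} \<Longrightarrow> g t \<in> V" and "d > 0" for g d
  proof -
    obtain e where e: "e > 0" "\<And>t. t \<in> {0..1} \<Longrightarrow> power_ball n (g t) e \<subseteq> V"
      using pathin_uniform_neighbourhood[OF g(1) V(1) g(2)] by blast
    obtain F where F: "F \<in> {..<n} \<rightarrow>\<^sub>E UNIV" "\<And>t. t \<in> {0..1} \<Longrightarrow> tuple_path n F t = g t"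
      using tuple_path_of_path[OF g(1)] by blast
    \<comment> \<open>The bound \<open>e\<close> keeps the perturbed path in \<open>V\<close>; the
      bound \<open>d\<close> is the requested closeness.\<close>
    have "min d e > 0" using e \<open>d > 0\<close> by simp
    then obtain G where G: "G \<in> Lg n" "G \<in> power_ball n F (min d e)"
      using D F(1) unfolding Lg_dense_def by blast
    have "tuple_path n G t \<in> W \<inter> power_ball n (g t) d" if t: "t \<in> {0..1}" for t
    proof -
      have close: "tuple_path n G t \<in> power_ball n (g t) (min d e)"
        using tuple_path_power_ball[OF G(2) t] by (simp add: F(2)[OF t])
      have "tuple_path n G t \<in> Lg n"
        using G(1) Lg_C_I_iff[OF good] Lg_subset t by blast
      moreover have "tuple_path n G t \<in> power_ball n (g t) e" "tuple_path n G t \<in> power_ball n (g t) d"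
        using close power_ball_mono[of "min d e" e n "g t"] power_ball_mono[of "min d e" d n "g t"]
        by auto
      ultimately show ?thesis using e(2)[OF t] by (auto simp: W_def)
    qed
    then show ?thesis
      using pathin_tuple_path[of n G] by blast
  qed
  have near: "\<exists>d>0. \<forall>y \<in> power_ball n x d. path_component_of (subtopology (power_topology n) W) x y"
    if "x \<in> W" for x
  proof -
    from that W obtain d where d: "d > 0" "power_ball n x d \<subseteq> W"
      and x: "x \<in> {..<n} \<rightarrow>\<^sub>E UNIV"
      unfolding openin_power_topology_iff by blast
    have "path_connectedin (subtopology (power_topology n) W) (power_ball n x d)"
      using d(2) path_connectedin_power_ball[of n x d] by (simp add: path_connectedin_subtopology)
    then have "power_ball n x d \<subseteq> Collect (path_component_of (subtopology (power_topology n) W) x)"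
      using power_ball_centre[OF x d(1)] by (rule path_component_of_maximal)
    then show ?thesis using d(1) by blast
  qed
  \<comment> \<open>A perturbation of a constant path in \<open>V\<close> already supplies a point
    of \<open>W\<close>.\<close>
  have "W \<noteq> {}"
  proof -
    obtain v where "v \<in> V" using V(2) by blast
    moreover from this have "pathin (power_topology n) (\<lambda>_. v)"
      using openin_subset[OF V(1)] by (simp add: pathin_const subsetD)
    ultimately obtain h where "\<forall>t\<in>{0..1::real}. h t \<in> W \<inter> power_ball n v 1"
      using approx[of "\<lambda>_. v" 1] by auto
    then have "h 0 \<in> W" by simp
    then show ?thesis by blast
  qed
  then show "V \<inter> Lg n \<noteq> {}" by (simp add: W_def)
  have "path_component_of (subtopology (power_topology n) W) x y" if x: "x \<in> W" and y: "y \<in> W" for x y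
  proof -
    let ?c = "path_component_of (subtopology (power_topology n) W)"
    have "x \<in> V" "y \<in> V" using x y by (simp_all add: W_def)
    then obtain g where g: "pathin (power_topology n) g" "g ` {0..1} \<subseteq> V" and g01: "g 0 = x" "g 1 = y"
      using V(3) unfolding path_connectedin image_subset_iff_funcset by blast
    obtain d where d: "d > 0" "\<And>z. z \<in> power_ball n x d \<Longrightarrow> ?c x z"
      using near[OF x] by blast
    obtain e where e: "e > 0" "\<And>z. z \<in> power_ball n y e \<Longrightarrow> ?c y z"
      using near[OF y] by blast
    \<comment> \<open>With this radius \<open>h 0\<close> and \<open>h 1\<close> fall into the cubes
      around \<open>x\<close> and \<open>y\<close> provided by \<open>near\<close>.\<close>
    have "min d e > 0" using d(1) e(1) by simp
    then obtain h where h: "pathin (power_topology n) h"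
      "\<And>t. t \<in> {0..1} \<Longrightarrow> h t \<in> W \<inter> power_ball n (g t) (min d e)"
      using approx[OF g(1), of "min d e"] g(2) by blast
    have "pathin (subtopology (power_topology n) W) h"
      using h by (auto simp: pathin_subtopology)
    then have "?c (h 0) (h 1)" unfolding path_component_of_def by blast
    moreover have "h 0 \<in> power_ball n x d" "h 1 \<in> power_ball n y e"
      using h(2)[of 0] h(2)[of 1] power_ball_mono[of "min d e" d n x]
        power_ball_mono[of "min d e" e n y] by (auto simp: g01)
    then have "?c x (h 0)" "?c y (h 1)" by (simp_all add: d(2) e(2))
    ultimately show ?thesis
      by (meson path_component_of_sym path_component_of_trans)
  qed
  then have "path_connectedin (power_topology n) W"
    using openin_subset[OF W]
    by (auto simp: path_connectedin_def path_connected_space_iff_path_component)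
  then show "path_connectedin (power_topology n) (V \<inter> Lg n)" by (simp add: W_def)
qed fact

text \<open>Bisection applies to the statement that any points of \<open>Lg n\<close> within
  \<open>e\<close> of \<open>f a\<close> and \<open>f b\<close> can be joined over
  \<open>{a..b}\<close> by a path in \<open>Lg n\<close> within \<open>3 * e\<close> of
  \<open>f\<close>. Prescribing both endpoints is what allows pieces to be concatenated.\<close>

lemma Lg_path_near_path:
  fixes f :: "real \<Rightarrow> nat \<Rightarrow> 'a::complex_normed_unital_algebra"
  assumes R: "in_acs_range TYPE('a) n" and e: "e > 0"
    and f: "pathin (power_topology n) f"
  obtains g where "pathin (power_topology n) g"
    "\<And>t. t \<in> {0..1} \<Longrightarrow> g t \<in> Lg n \<inter> power_ball n (f t) (3 * e)"
proof -
  have Pi: "f t \<in> {..<n} \<rightarrow>\<^sub>E UNIV" if "t \<in> {0..1}" for t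
    using f that by (simp add: pathin_power_iff)
  define B where "B r t = power_ball n (f t) r \<inter> Lg n" for r t
  have B_ne: "B r t \<noteq> {}" and B_conn: "path_connectedin (power_topology n) (B r t)"
    if "r > 0" "t \<in> {0..1}" for r t
  proof -
    have "power_ball n (f t) r \<noteq> {}" using power_ball_centre[OF Pi] that by blast
    moreover note openin_power_ball[of n "f t" r] path_connectedin_power_ball[of n "f t" r]
    ultimately have "power_ball n (f t) r \<inter> Lg n \<noteq> {} \<and>
        path_connectedin (power_topology n) (power_ball n (f t) r \<inter> Lg n)"
      using R unfolding in_acs_range_def by blast
    then show "B r t \<noteq> {}" "path_connectedin (power_topology n) (B r t)"
      by (simp_all add: B_def)
  qed
  define joins where "joins g a b p q \<longleftrightarrow> g a = p \<and> g b = q \<and>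
    (\<forall>i<n. continuous_on {a..b} (\<lambda>t. g t i)) \<and> (\<forall>t\<in>{a..b}. g t \<in> B (3 * e) t)"
    for g :: "real \<Rightarrow> nat \<Rightarrow> 'a" and a b p q
  \<comment> \<open>Degenerate intervals are excluded: for \<open>a = b\<close>, distinct
    \<open>p\<close> and \<open>q\<close> could not be joined.\<close>
  define P where "P a b \<longleftrightarrow> (0 \<le> a \<and> a < b \<and> b \<le> 1 \<longrightarrow>
    (\<forall>p\<in>B e a. \<forall>q\<in>B e b. \<exists>g. joins g a b p q))" for a b
  have "P 0 1"
  proof (rule Bolzano)
    fix a b c assume P: "P a b" "P b c" and le: "a \<le> b" "b \<le> c"
    show "P a c"
    proof (cases "a < b \<and> b < c \<and> 0 \<le> a \<and> c \<le> 1")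
      case False
      with P le show ?thesis by (cases "a = b"; cases "b = c") (auto simp: P_def)
    next
      case True
      show ?thesis unfolding P_def
      proof (intro impI ballI)
        fix p q assume p: "p \<in> B e a" and q: "q \<in> B e c"
        \<comment> \<open>Any point of \<open>Lg n\<close> in the cube around \<open>f b\<close> can
          serve as the junction; \<open>Lg n\<close> meets every such cube.\<close>
        obtain m where m: "m \<in> B e b"
          using B_ne[OF e, of b] True by auto
        have "0 \<le> a \<and> a < b \<and> b \<le> 1" "0 \<le> b \<and> b < c \<and> c \<le> 1" using True by auto
        with P p q m obtain g h where g: "joins g a b p m" and h: "joins h b c m q"
          unfolding P_def by blast
        define k where "k t = (if t \<le> b then g t else h t)" for t
        have "continuous_on {a..c} (\<lambda>t. if t \<le> b then g t i else h t i)" if "i < n" for i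
          using that g h le by (intro continuous_on_glue) (auto simp: joins_def)
        moreover have "k t i = (if t \<le> b then g t i else h t i)" for t i
          by (simp add: k_def)
        moreover have "k t \<in> B (3 * e) t" if "t \<in> {a..c}" for t
          using that g h by (simp add: k_def joins_def)
        moreover have "k a = p" "k c = q"
          using g h True by (simp_all add: k_def joins_def)
        ultimately have "joins k a c p q" by (simp add: joins_def)
        then show "\<exists>g. joins g a c p q" by blast
      qed
    qed
  next
    fix x :: real assume "0 \<le> x" "x \<le> 1"
    then have x: "x \<in> {0..1}" by simp
    obtain d where d: "d > 0"
      "\<And>t. t \<in> {0..1} \<Longrightarrow> dist x t < d \<Longrightarrow> f t \<in> power_ball n (f x) e"
      using pathin_power_near[OF f x e] by blast
    have "P a b" if ab: "a \<le> x" "x \<le> b" "b - a < d" for a b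
      unfolding P_def
    proof (intro impI ballI)
      fix p q assume ab': "0 \<le> a \<and> a < b \<and> b \<le> 1" and p: "p \<in> B e a" and q: "q \<in> B e b"
      have fx: "f t \<in> power_ball n (f x) e" if "t \<in> {a..b}" for t
        using that ab ab' by (intro d(2)) (auto simp: dist_real_def)
      \<comment> \<open>On a short interval all cubes of radius \<open>e\<close> lie in one cube of
        radius \<open>2 * e\<close> around \<open>f x\<close>, whose intersection with
        \<open>Lg n\<close> is path-connected.\<close>
      have "B e t \<subseteq> B (2 * e) x" if "t \<in> {a..b}" for t
        using power_ball_triangle[OF fx[OF that], of _ e] by (auto simp: B_def)
      then have "p \<in> B (2 * e) x" "q \<in> B (2 * e) x"
        using p q ab' by (meson atLeastAtMost_iff less_imp_le order_refl subsetD)+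
      moreover have "path_connectedin (power_topology n) (B (2 * e) x)"
        using e x by (intro B_conn) auto
      ultimately obtain h where h: "pathin (power_topology n) h" "h ` {0..1} \<subseteq> B (2 * e) x"
        and h01: "h 0 = p" "h 1 = q"
        unfolding path_connectedin image_subset_iff_funcset by blast
      \<comment> \<open>Affine reparametrisation from \<open>{a..b}\<close> to
        \<open>{0..1}\<close>, legitimate since \<open>a < b\<close>.\<close>
      define g where "g t = h ((t - a) / (b - a))" for t
      have unit: "(t - a) / (b - a) \<in> {0..1}" if "t \<in> {a..b}" for t
        using that ab' by auto
      have "continuous_on {a..b} (\<lambda>t. g t i)" if "i < n" for i
      proof -
        have "continuous_on {0..1} (\<lambda>s. h s i)" using h(1) that by (simp add: pathin_power_iff)
        then show ?thesis
          unfolding g_def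
          by (rule continuous_on_compose2) (use unit ab' in \<open>auto intro!: continuous_intros\<close>)
      qed
      moreover have "g t \<in> B (3 * e) t" if t: "t \<in> {a..b}" for t
      proof -
        have gt: "g t \<in> power_ball n (f x) (2 * e)" "g t \<in> Lg n"
          using h(2) unit[OF t] by (auto simp: g_def B_def)
        have "f x \<in> power_ball n (f t) e"
          using Pi[OF x] fx[OF t] by (rule power_ball_commute)
        \<comment> \<open>Moving the centre back from \<open>f x\<close> to \<open>f t\<close> costs
          another \<open>e\<close>, whence the factor 3.\<close>
        then have "g t \<in> power_ball n (f t) (e + 2 * e)" using gt(1) by (rule power_ball_triangle)
        then show ?thesis using gt(2) by (simp add: B_def)
      qed
      ultimately have "joins g a b p q"
        using h01 ab' by (simp add: joins_def g_def)
      then show "\<exists>g. joins g a b p q" by blast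
    qed
    then show "\<exists>d>0. \<forall>a b. a \<le> x \<and> x \<le> b \<and> b - a < d \<longrightarrow> P a b" using d(1) by blast
  qed simp
  moreover obtain p q where "p \<in> B e 0" "q \<in> B e 1"
    using B_ne[OF e, of 0] B_ne[OF e, of 1] by auto
  ultimately obtain g where g: "joins g 0 1 p q"
    unfolding P_def by auto
  show ?thesis
  proof (rule that)
    show "g t \<in> Lg n \<inter> power_ball n (f t) (3 * e)" if "t \<in> {0..1}" for t
      using g that by (simp add: joins_def B_def)
    then have "g t \<in> {..<n} \<rightarrow>\<^sub>E UNIV" if "t \<in> {0..1}" for t
      using that Lg_subset by blast
    then show "pathin (power_topology n) g"
      using g by (simp add: pathin_power_iff joins_def)
  qed
qed

lemma Lg_dense_if_in_acs_range:
  assumes good: "good_algebra TYPE('a::complex_normed_unital_algebra)"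
    and R: "in_acs_range TYPE('a) n"
  shows "Lg_dense TYPE('a C_I) n"
  unfolding Lg_dense_def
proof (intro ballI allI impI)
  fix F :: "nat \<Rightarrow> 'a C_I" and e :: real
  assume e: "e > 0"
  \<comment> \<open>The path comes within \<open>3 * (e / 6) = e / 2\<close>. Passing to the
    supremum over \<open>t\<close> weakens the strict inequality, and the spare half of
    \<open>e\<close> restores it.\<close>
  then have "e / 6 > 0" by simp
  then obtain g where g: "pathin (power_topology n) g"
    "\<And>t. t \<in> {0..1} \<Longrightarrow> g t \<in> Lg n \<inter> power_ball n (tuple_path n F t) (3 * (e / 6))"
    using Lg_path_near_path[OF R _ pathin_tuple_path] by blast
  obtain G where G: "G \<in> {..<n} \<rightarrow>\<^sub>E UNIV" "\<And>t. t \<in> {0..1} \<Longrightarrow> tuple_path n G t = g t"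
    using tuple_path_of_path[OF g(1)] by blast
  have "G \<in> Lg n" using Lg_C_I_iff[OF good G(1)] G(2) g(2) by simp
  moreover have "dist (F i) (G i) < e" if "i < n" for i
  proof -
    have "dist (apply_C_I (F i) t) (apply_C_I (G i) t) \<le> e / 2" if t: "t \<in> {0..1}" for t
    proof -
      have "tuple_path n G t \<in> power_ball n (tuple_path n F t) (3 * (e / 6))"
        using g(2)[OF t] by (simp add: G(2)[OF t])
      then have "dist (tuple_path n F t i) (tuple_path n G t i) < 3 * (e / 6)"
        using \<open>i < n\<close> unfolding mem_power_ball by blast
      then show ?thesis using \<open>i < n\<close> by simp
    qed
    then have "dist (F i) (G i) \<le> e / 2" by (rule dist_C_I_leI)
    with e show ?thesis by simp
  qed
  then have "G \<in> power_ball n F e" using G(1) by (simp add: mem_power_ball)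
  ultimately show "Lg n \<inter> power_ball n F e \<noteq> {}" by blast
qed

theorem theorem3p9:
  assumes "good_algebra TYPE('a::complex_normed_unital_algebra)"
  shows "(\<forall>n>0. in_acs_range TYPE('a) n \<longleftrightarrow> tsr TYPE('a C_I) \<le> enat n) \<and>
         acsr TYPE('a) = tsr TYPE('a C_I)"
proof -
  have iff: "in_acs_range TYPE('a) n \<longleftrightarrow> Lg_dense TYPE('a C_I) n" if "n > 0" for n
    using in_acs_range_if_Lg_dense[OF assms that] Lg_dense_if_in_acs_range[OF assms] by blast
  \<comment> \<open>Density at \<open>n\<close> implies density at every \<open>m \<ge> n\<close>,
    which absorbs the quantifier over \<open>m\<close>; the two infima are then taken over the same
    set.\<close>
  have "n > 0 \<and> (\<forall>m\<ge>n. in_acs_range TYPE('a) m) \<longleftrightarrow> n > 0 \<and> Lg_dense TYPE('a C_I) n" for n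
    using iff Lg_dense_mono[where 'a = "'a C_I"] by (meson order.refl order.strict_trans2)
  then have "acsr TYPE('a) = tsr TYPE('a C_I)"
    by (simp add: acsr_def tsr_def Lg_dense_iff)
  with iff show ?thesis by (simp add: tsr_le_iff)
qed

end
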